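(* Let $(L,A,\cdot,\ell)$ be a left-symmetric Rinehart algebra over a field $\mathbb K$ of characteristic zero and let $(M;\rho,\mu)$ be a representation of it. Let $M^*=\mathrm{Hom}_A(M,A)$ and define, for $x\in L$, $\xi\in M^*$, $m\in M$, $$\langle\rho^*(x)\xi,m\rangle=\ell(x)\langle\xi,m\rangle-\langle\xi,\rho(x)m\rangle,\qquad \langle\mu^*(x)\xi,m\rangle=-\langle\xi,\mu(x)m\rangle.$$ Then: (i) $(M,\rho-\mu)$ is a representation of the sub-adjacent Lie-Rinehart algebra $(L,A,[\cdot,\cdot],\ell)$, where $[x,y]=x\cdot y-y\cdot x$. (ii) $(M^*;\rho^*-\mu^*,-\mu^* )$ is a representation of the left-symmetric Rinehart algebra $(L,A,\cdot,\ell)$.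
   Context: All vector spaces are over a field $\mathbb K$ of characteristic zero. A left-symmetric Rinehart algebra is a quadruple $(L,A,\cdot,\ell)$ where $A$ is an associative commutative $\mathbb K$-algebra, $L$ is an $A$-module with a bilinear product satisfying $(x\cdot y)\cdot z-x\cdot(y\cdot z)=(y\cdot x)\cdot z-y\cdot(x\cdot z)$, and $\ell:L\to \mathrm{Der}(A)$ is a linear map such that $\ell(x\cdot y-y\cdot x)=\ell(x)\ell(y)-\ell(y)\ell(x)$, $\ell(ax)=a\ell(x)$, $x\cdot(ay)=\ell(x)(a)\,y+a(x\cdot y)$, and $(ax)\cdot y=a(x\cdot y)$ for all $a\in A$, $x,y,z\in L$. With $[x,y]=x\cdot y-y\cdot x$, the quadruple $(L,A,[\cdot,\cdot],\ell)$ is a Lie-Rinehart algebra, called sub-adjacent. A representation of the Lie-Rinehart algebra $(L,A,[\cdot,\cdot],\ell)$ on an $A$-module $M$ is a linear map $\theta:L\to\mathrm{End}_{\mathbb K}(M)$ with $\theta([x,y])=\theta(x)\theta(y)-\theta(y)\theta(x)$, $\theta(ax)m=a\theta(x)m$ and $\theta(x)(am)=a\theta(x)m+\ell(x)(a)m$. A representation $(M;\rho,\mu)$ of $(L,A,\cdot,\ell)$ consists of an $A$-module $M$, a representation $\rho$ of the sub-adjacent Lie-Rinehart algebra on $M$, and a linear map $\mu:L\to \mathrm{End}_{\mathbb K}(M)$ with $\mu(ax)m=a\mu(x)m=\mu(x)(am)$ and $\rho(x)\mu(y)-\mu(y)\rho(x)=\mu(x\cdot y)-\mu(y)\mu(x)$,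 for all $x,y\in L$, $a\in A$, $m\in M$. $\langle\xi,m\rangle=\xi(m)\in A$ denotes the evaluation pairing, and $M^*$ has the $A$-module structure $(a\xi)(m)=a\,\xi(m)$. *)

theory Defs
  imports "Jordan_Normal_Form.Missing_VectorSpace"
begin

locale char_zero_field = field K for K (structure) +
  assumes char_zero: "n > 0 \<Longrightarrow> [(n::nat)] \<cdot> \<one> \<noteq> \<zero>"

text \<open>
  Algebras are commutative and unital and modules are unital, as in HOL-Algebra. Hence an
  \<open>A\<close>-module carries exactly one compatible \<open>K\<close>-vector space structure, namely the one obtained
  by restricting scalars along \<open>k \<mapsto> k \<cdot> 1\<close>.
\<close>

definition restrict_scalars ::
  "('k, 'a) module \<Rightarrow> ('a, 'm) module \<Rightarrow> ('k, 'm) module" where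
  "restrict_scalars A M =
     \<lparr>carrier = carrier M, mult = mult M, one = one M, zero = zero M, add = add M,
      smult = (\<lambda>k m. (k \<odot>\<^bsub>A\<^esub> \<one>\<^bsub>A\<^esub>) \<odot>\<^bsub>M\<^esub> m)\<rparr>"

definition regular_module :: "('k, 'a) module \<Rightarrow> ('a, 'a) module" where
  "regular_module A =
     \<lparr>carrier = carrier A, mult = mult A, one = one A, zero = zero A, add = add A,
      smult = mult A\<rparr>"

text \<open>
  \<open>bilinear_on K U V W f\<close> says that \<open>f\<close> is a \<open>K\<close>-bilinear map \<open>U \<times> V \<rightarrow> W\<close>, or equally that \<open>f\<close>
  is a \<open>K\<close>-linear map from \<open>U\<close> to the space of \<open>K\<close>-linear maps \<open>V \<rightarrow> W\<close>. In particular a linear map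
  from \<open>L\<close> to the endomorphisms of \<open>M\<close> is a function \<open>\<theta>\<close> with \<open>bilinear_on K L M M \<theta>\<close>.
\<close>

definition bilinear_on ::
  "'k ring \<Rightarrow> ('k, 'u) module \<Rightarrow> ('k, 'v) module \<Rightarrow> ('k, 'w) module \<Rightarrow>
   ('u \<Rightarrow> 'v \<Rightarrow> 'w) \<Rightarrow> bool" where
  "bilinear_on K U V W f \<longleftrightarrow>
     (\<forall>u\<in>carrier U. f u \<in> module_hom K V W) \<and>
     (\<forall>v\<in>carrier V. (\<lambda>u. f u v) \<in> module_hom K U W)"

definition derivations :: "'k ring \<Rightarrow> ('k, 'a) module \<Rightarrow> ('a \<Rightarrow> 'a) set" where
  "derivations K A =
     {D \<in> module_hom K A A. \<forall>a\<in>carrier A. \<forall>b\<in>carrier A.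
        D (a \<otimes>\<^bsub>A\<^esub> b) = D a \<otimes>\<^bsub>A\<^esub> b \<oplus>\<^bsub>A\<^esub> a \<otimes>\<^bsub>A\<^esub> D b}"

definition commutator :: "('a, 'l) module \<Rightarrow> ('l \<Rightarrow> 'l \<Rightarrow> 'l) \<Rightarrow> 'l \<Rightarrow> 'l \<Rightarrow> 'l" where
  "commutator L pr x y = pr x y \<ominus>\<^bsub>L\<^esub> pr y x"

locale left_symmetric_rinehart_algebra =
  K?: field K + A?: algebra K A + L?: module A L
  for K :: "'k ring" and A :: "('k, 'a) module" and L :: "('a, 'l) module" +
  fixes pr :: "'l \<Rightarrow> 'l \<Rightarrow> 'l" and ell :: "'l \<Rightarrow> 'a \<Rightarrow> 'a"
  assumes pr_bilinear:
      "bilinear_on K (restrict_scalars A L) (restrict_scalars A L) (restrict_scalars A L) pr"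
    and left_symmetric:
      "\<lbrakk>x \<in> carrier L; y \<in> carrier L; z \<in> carrier L\<rbrakk> \<Longrightarrow>
         pr (pr x y) z \<ominus>\<^bsub>L\<^esub> pr x (pr y z) = pr (pr y x) z \<ominus>\<^bsub>L\<^esub> pr y (pr x z)"
    and anchor_derivation: "x \<in> carrier L \<Longrightarrow> ell x \<in> derivations K A"
    and anchor_linear: "bilinear_on K (restrict_scalars A L) A A ell"
    and anchor_commutator:
      "\<lbrakk>x \<in> carrier L; y \<in> carrier L; a \<in> carrier A\<rbrakk> \<Longrightarrow>
         ell (pr x y \<ominus>\<^bsub>L\<^esub> pr y x) a = ell x (ell y a) \<ominus>\<^bsub>A\<^esub> ell y (ell x a)"
    and anchor_smult:
      "\<lbrakk>a \<in> carrier A; x \<in> carrier L; b \<in> carrier A\<rbrakk> \<Longrightarrow> ell (a \<odot>\<^bsub>L\<^esub> x) b = a \<otimes>\<^bsub>A\<^esub> ell x b"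
    and pr_smult_right:
      "\<lbrakk>a \<in> carrier A; x \<in> carrier L; y \<in> carrier L\<rbrakk> \<Longrightarrow>
         pr x (a \<odot>\<^bsub>L\<^esub> y) = ell x a \<odot>\<^bsub>L\<^esub> y \<oplus>\<^bsub>L\<^esub> a \<odot>\<^bsub>L\<^esub> pr x y"
    and pr_smult_left:
      "\<lbrakk>a \<in> carrier A; x \<in> carrier L; y \<in> carrier L\<rbrakk> \<Longrightarrow> pr (a \<odot>\<^bsub>L\<^esub> x) y = a \<odot>\<^bsub>L\<^esub> pr x y"

locale lie_rinehart_algebra =
  K?: field K + A?: algebra K A + L?: module A L
  for K :: "'k ring" and A :: "('k, 'a) module" and L :: "('a, 'l) module" +
  fixes br :: "'l \<Rightarrow> 'l \<Rightarrow> 'l" and ell :: "'l \<Rightarrow> 'a \<Rightarrow> 'a"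
  assumes br_bilinear:
      "bilinear_on K (restrict_scalars A L) (restrict_scalars A L) (restrict_scalars A L) br"
    and br_alternating: "x \<in> carrier L \<Longrightarrow> br x x = \<zero>\<^bsub>L\<^esub>"
    and jacobi:
      "\<lbrakk>x \<in> carrier L; y \<in> carrier L; z \<in> carrier L\<rbrakk> \<Longrightarrow>
         br x (br y z) \<oplus>\<^bsub>L\<^esub> br y (br z x) \<oplus>\<^bsub>L\<^esub> br z (br x y) = \<zero>\<^bsub>L\<^esub>"
    and anchor_derivation: "x \<in> carrier L \<Longrightarrow> ell x \<in> derivations K A"
    and anchor_linear: "bilinear_on K (restrict_scalars A L) A A ell"
    and anchor_bracket:
      "\<lbrakk>x \<in> carrier L; y \<in> carrier L; a \<in> carrier A\<rbrakk> \<Longrightarrow>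
         ell (br x y) a = ell x (ell y a) \<ominus>\<^bsub>A\<^esub> ell y (ell x a)"
    and anchor_smult:
      "\<lbrakk>a \<in> carrier A; x \<in> carrier L; b \<in> carrier A\<rbrakk> \<Longrightarrow> ell (a \<odot>\<^bsub>L\<^esub> x) b = a \<otimes>\<^bsub>A\<^esub> ell x b"
    and br_smult_right:
      "\<lbrakk>a \<in> carrier A; x \<in> carrier L; y \<in> carrier L\<rbrakk> \<Longrightarrow>
         br x (a \<odot>\<^bsub>L\<^esub> y) = ell x a \<odot>\<^bsub>L\<^esub> y \<oplus>\<^bsub>L\<^esub> a \<odot>\<^bsub>L\<^esub> br x y"

text \<open>
  The sub-adjacent algebra of a left-symmetric Rinehart algebra is a Lie--Rinehart algebra, so
  speaking of its representations puts no further condition on the base.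
\<close>

lemma (in left_symmetric_rinehart_algebra) sub_adjacent_lie_rinehart:
  "lie_rinehart_algebra K A L (commutator L pr) ell"
proof -
  let ?b = "commutator L pr"
  have pc [simp, intro]: "pr x y \<in> carrier L" if "x \<in> carrier L" "y \<in> carrier L" for x y
    using pr_bilinear that
    by (auto simp: bilinear_on_def module_hom_def restrict_scalars_def)
  have pa1: "pr x (y \<oplus>\<^bsub>L\<^esub> z) = pr x y \<oplus>\<^bsub>L\<^esub> pr x z"
    if "x \<in> carrier L" "y \<in> carrier L" "z \<in> carrier L" for x y z
    using pr_bilinear that
    by (auto simp: bilinear_on_def module_hom_def restrict_scalars_def)
  have pa2: "pr (x \<oplus>\<^bsub>L\<^esub> y) z = pr x z \<oplus>\<^bsub>L\<^esub> pr y z"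
    if "x \<in> carrier L" "y \<in> carrier L" "z \<in> carrier L" for x y z
    using pr_bilinear that
    by (auto simp: bilinear_on_def module_hom_def restrict_scalars_def)
  have ka [simp, intro]: "k \<odot>\<^bsub>A\<^esub> \<one>\<^bsub>A\<^esub> \<in> carrier A" if "k \<in> carrier K" for k
    using that by simp
  have pk1: "pr x ((k \<odot>\<^bsub>A\<^esub> \<one>\<^bsub>A\<^esub>) \<odot>\<^bsub>L\<^esub> y) = (k \<odot>\<^bsub>A\<^esub> \<one>\<^bsub>A\<^esub>) \<odot>\<^bsub>L\<^esub> pr x y"
    if "k \<in> carrier K" "x \<in> carrier L" "y \<in> carrier L" for k x y
    using pr_bilinear that
    by (auto simp: bilinear_on_def module_hom_def restrict_scalars_def)
  have pz1: "pr x \<zero>\<^bsub>L\<^esub> = \<zero>\<^bsub>L\<^esub>" if "x \<in> carrier L" for x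
    using pa1[of x "\<zero>\<^bsub>L\<^esub>" "\<zero>\<^bsub>L\<^esub>"] that by simp
  have pz2: "pr \<zero>\<^bsub>L\<^esub> x = \<zero>\<^bsub>L\<^esub>" if "x \<in> carrier L" for x
    using pa2[of "\<zero>\<^bsub>L\<^esub>" "\<zero>\<^bsub>L\<^esub>" x] that by simp
  have pn1: "pr x (\<ominus>\<^bsub>L\<^esub> y) = \<ominus>\<^bsub>L\<^esub> pr x y" if "x \<in> carrier L" "y \<in> carrier L" for x y
    using pa1[of x "\<ominus>\<^bsub>L\<^esub> y" y] that pz1 by (simp add: L.M.l_neg L.M.minus_equality)
  have pn2: "pr (\<ominus>\<^bsub>L\<^esub> x) y = \<ominus>\<^bsub>L\<^esub> pr x y" if "x \<in> carrier L" "y \<in> carrier L" for x y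
    using pa2[of "\<ominus>\<^bsub>L\<^esub> x" x y] that pz2 by (simp add: L.M.l_neg L.M.minus_equality)
  have add_l: "?b (x \<oplus>\<^bsub>L\<^esub> y) z = ?b x z \<oplus>\<^bsub>L\<^esub> ?b y z"
    and add_r: "?b z (x \<oplus>\<^bsub>L\<^esub> y) = ?b z x \<oplus>\<^bsub>L\<^esub> ?b z y"
    if "x \<in> carrier L" "y \<in> carrier L" "z \<in> carrier L" for x y z
    using that by (simp_all add: commutator_def pa1 pa2 a_minus_def L.M.minus_add L.M.a_ac)
  have smult_l: "?b ((k \<odot>\<^bsub>A\<^esub> \<one>\<^bsub>A\<^esub>) \<odot>\<^bsub>L\<^esub> x) y = (k \<odot>\<^bsub>A\<^esub> \<one>\<^bsub>A\<^esub>) \<odot>\<^bsub>L\<^esub> ?b x y"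
    and smult_r: "?b x ((k \<odot>\<^bsub>A\<^esub> \<one>\<^bsub>A\<^esub>) \<odot>\<^bsub>L\<^esub> y) = (k \<odot>\<^bsub>A\<^esub> \<one>\<^bsub>A\<^esub>) \<odot>\<^bsub>L\<^esub> ?b x y"
    if "k \<in> carrier K" "x \<in> carrier L" "y \<in> carrier L" for k x y
    using that
    by (simp_all add: commutator_def pk1 pr_smult_left a_minus_def L.smult_r_distr L.smult_r_minus)
  have bc: "?b x y \<in> carrier L" if "x \<in> carrier L" "y \<in> carrier L" for x y
    using that by (simp add: commutator_def)
  have ls: "pr x (pr y z) \<oplus>\<^bsub>L\<^esub> (\<ominus>\<^bsub>L\<^esub> pr (pr x y) z \<oplus>\<^bsub>L\<^esub> (pr (pr y x) z \<oplus>\<^bsub>L\<^esub> \<ominus>\<^bsub>L\<^esub> pr y (pr x z))) = \<zero>\<^bsub>L\<^esub>"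
    if c: "x \<in> carrier L" "y \<in> carrier L" "z \<in> carrier L" for x y z
  proof -
    have "pr (pr y x) z \<oplus>\<^bsub>L\<^esub> \<ominus>\<^bsub>L\<^esub> pr y (pr x z) = pr (pr x y) z \<oplus>\<^bsub>L\<^esub> \<ominus>\<^bsub>L\<^esub> pr x (pr y z)"
      using left_symmetric[OF c] by (simp add: a_minus_def)
    then show ?thesis using c by (simp add: L.M.r_neg1 L.M.r_neg2 L.M.r_neg)
  qed
  have jac: "?b x (?b y z) \<oplus>\<^bsub>L\<^esub> ?b y (?b z x) \<oplus>\<^bsub>L\<^esub> ?b z (?b x y) = \<zero>\<^bsub>L\<^esub>"
    if c: "x \<in> carrier L" "y \<in> carrier L" "z \<in> carrier L" for x y z
  proof -
    let ?E = "\<lambda>x y z. pr x (pr y z) \<oplus>\<^bsub>L\<^esub> (\<ominus>\<^bsub>L\<^esub> pr (pr x y) z \<oplus>\<^bsub>L\<^esub> (pr (pr y x) z \<oplus>\<^bsub>L\<^esub> \<ominus>\<^bsub>L\<^esub> pr y (pr x z)))"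
    have "?b x (?b y z) \<oplus>\<^bsub>L\<^esub> ?b y (?b z x) \<oplus>\<^bsub>L\<^esub> ?b z (?b x y) = ?E x y z \<oplus>\<^bsub>L\<^esub> (?E y z x \<oplus>\<^bsub>L\<^esub> ?E z x y)"
      using c by (simp add: commutator_def a_minus_def pa1 pa2 pn1 pn2 L.M.minus_add L.M.a_ac)
    also have "\<dots> = \<zero>\<^bsub>L\<^esub>"
      using c by (simp only: ls) simp
    finally show ?thesis .
  qed
  show ?thesis
  proof (intro lie_rinehart_algebra.intro lie_rinehart_algebra_axioms.intro)
    show "field K" "algebra K A" "module A L" by unfold_locales
    show "bilinear_on K (restrict_scalars A L) (restrict_scalars A L) (restrict_scalars A L) ?b"
      by (auto simp: bilinear_on_def module_hom_def restrict_scalars_def bc add_l add_r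
          smult_l smult_r)
    show "?b x x = \<zero>\<^bsub>L\<^esub>" if "x \<in> carrier L" for x
      using that by (simp add: commutator_def a_minus_def L.M.r_neg)
    show "?b x (a \<odot>\<^bsub>L\<^esub> y) = ell x a \<odot>\<^bsub>L\<^esub> y \<oplus>\<^bsub>L\<^esub> a \<odot>\<^bsub>L\<^esub> ?b x y"
      if "a \<in> carrier A" "x \<in> carrier L" "y \<in> carrier L" for a x y
    proof -
      have "ell x a \<in> carrier A"
        using anchor_derivation[OF that(2)] that(1)
        by (auto simp: derivations_def module_hom_def)
      then show ?thesis
        using that
        by (simp add: commutator_def pr_smult_left pr_smult_right a_minus_def L.smult_r_distr
            L.smult_r_minus L.M.a_assoc)
    qed
  qed (use jac anchor_derivation anchor_linear anchor_commutator anchor_smult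
      in \<open>simp_all add: commutator_def\<close>)
qed

locale lie_rinehart_representation =
  lie_rinehart_algebra K A L br ell + M?: module A M
  for K :: "'k ring" and A :: "('k, 'a) module" and L :: "('a, 'l) module"
    and br ell and M :: "('a, 'm) module" +
  fixes \<theta> :: "'l \<Rightarrow> 'm \<Rightarrow> 'm"
  assumes rep_linear:
      "bilinear_on K (restrict_scalars A L) (restrict_scalars A M) (restrict_scalars A M) \<theta>"
    and rep_bracket:
      "\<lbrakk>x \<in> carrier L; y \<in> carrier L; m \<in> carrier M\<rbrakk> \<Longrightarrow>
         \<theta> (br x y) m = \<theta> x (\<theta> y m) \<ominus>\<^bsub>M\<^esub> \<theta> y (\<theta> x m)"
    and rep_smult:
      "\<lbrakk>a \<in> carrier A; x \<in> carrier L; m \<in> carrier M\<rbrakk> \<Longrightarrow> \<theta> (a \<odot>\<^bsub>L\<^esub> x) m = a \<odot>\<^bsub>M\<^esub> \<theta> x m"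
    and rep_leibniz:
      "\<lbrakk>a \<in> carrier A; x \<in> carrier L; m \<in> carrier M\<rbrakk> \<Longrightarrow>
         \<theta> x (a \<odot>\<^bsub>M\<^esub> m) = a \<odot>\<^bsub>M\<^esub> \<theta> x m \<oplus>\<^bsub>M\<^esub> ell x a \<odot>\<^bsub>M\<^esub> m"

locale left_symmetric_rinehart_representation =
  left_symmetric_rinehart_algebra K A L pr ell +
  sub_adjacent?: lie_rinehart_representation K A L "commutator L pr" ell M \<rho>
  for K :: "'k ring" and A :: "('k, 'a) module" and L :: "('a, 'l) module"
    and pr ell and M :: "('a, 'm) module" and \<rho> :: "'l \<Rightarrow> 'm \<Rightarrow> 'm" +
  fixes \<mu> :: "'l \<Rightarrow> 'm \<Rightarrow> 'm"
  assumes mu_linear: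
      "bilinear_on K (restrict_scalars A L) (restrict_scalars A M) (restrict_scalars A M) \<mu>"
    and mu_smult_left:
      "\<lbrakk>a \<in> carrier A; x \<in> carrier L; m \<in> carrier M\<rbrakk> \<Longrightarrow> \<mu> (a \<odot>\<^bsub>L\<^esub> x) m = a \<odot>\<^bsub>M\<^esub> \<mu> x m"
    and mu_smult_right:
      "\<lbrakk>a \<in> carrier A; x \<in> carrier L; m \<in> carrier M\<rbrakk> \<Longrightarrow> a \<odot>\<^bsub>M\<^esub> \<mu> x m = \<mu> x (a \<odot>\<^bsub>M\<^esub> m)"
    and rho_mu:
      "\<lbrakk>x \<in> carrier L; y \<in> carrier L; m \<in> carrier M\<rbrakk> \<Longrightarrow>
         \<rho> x (\<mu> y m) \<ominus>\<^bsub>M\<^esub> \<mu> y (\<rho> x m) = \<mu> (pr x y) m \<ominus>\<^bsub>M\<^esub> \<mu> y (\<mu> x m)"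

text \<open>
  Elements of the dual are functions on the whole type, so they are normalised to be
  \<open>undefined\<close> outside \<open>carrier M\<close>; this makes equality in the dual the equality of maps on \<open>M\<close>.
  The \<open>mult\<close> and \<open>one\<close> fields of a module record are not part of the module structure.
\<close>

definition dual_module :: "('k, 'a) module \<Rightarrow> ('a, 'm) module \<Rightarrow> ('a, 'm \<Rightarrow> 'a) module" where
  "dual_module A M =
     \<lparr>carrier = module_hom A M (regular_module A) \<inter> extensional (carrier M),
      mult = undefined, one = undefined,
      zero = (\<lambda>m\<in>carrier M. \<zero>\<^bsub>A\<^esub>),
      add = (\<lambda>\<xi> \<eta>. \<lambda>m\<in>carrier M. \<xi> m \<oplus>\<^bsub>A\<^esub> \<eta> m),
      smult = (\<lambda>a \<xi>. \<lambda>m\<in>carrier M. a \<otimes>\<^bsub>A\<^esub> \<xi> m)\<rparr>"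

definition rho_star ::
  "('k, 'a) module \<Rightarrow> ('l \<Rightarrow> 'a \<Rightarrow> 'a) \<Rightarrow> ('a, 'm) module \<Rightarrow> ('l \<Rightarrow> 'm \<Rightarrow> 'm) \<Rightarrow>
   'l \<Rightarrow> ('m \<Rightarrow> 'a) \<Rightarrow> ('m \<Rightarrow> 'a)" where
  "rho_star A ell M \<rho> x \<xi> = (\<lambda>m\<in>carrier M. ell x (\<xi> m) \<ominus>\<^bsub>A\<^esub> \<xi> (\<rho> x m))"

definition mu_star ::
  "('k, 'a) module \<Rightarrow> ('a, 'm) module \<Rightarrow> ('l \<Rightarrow> 'm \<Rightarrow> 'm) \<Rightarrow>
   'l \<Rightarrow> ('m \<Rightarrow> 'a) \<Rightarrow> ('m \<Rightarrow> 'a)" where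
  "mu_star A M \<mu> x \<xi> = (\<lambda>m\<in>carrier M. \<ominus>\<^bsub>A\<^esub> \<xi> (\<mu> x m))"

end

theory Submission
  imports Defs
begin

text \<open>
  The compatibility of \<open>\<rho>\<close> and \<open>\<mu>\<close> makes the cross terms in the bracket of \<open>\<rho> x - \<mu> x\<close> and
  \<open>\<rho> y - \<mu> y\<close> cancel, which is the first claim. The dual \<open>\<theta>\<^sup>*\<close> of any representation \<open>\<theta>\<close> of a
  Lie--Rinehart algebra is a representation, and \<open>\<rho>\<^sup>* - \<mu>\<^sup>*\<close> is the dual of \<open>\<theta> = \<rho> - \<mu>\<close>; only
  the compatibility of \<open>\<rho>\<^sup>* - \<mu>\<^sup>*\<close> with \<open>-\<mu>\<^sup>*\<close> is left, and evaluated at a vector it is again the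
  compatibility of \<open>\<rho>\<close> and \<open>\<mu>\<close>.
\<close>

section \<open>Bilinearity over the ground field in terms of module operations over
  \<open>A\<close>\<close>

lemma bilinear_on_restrict_scalars:
  "bilinear_on K (restrict_scalars A U) (restrict_scalars A V) (restrict_scalars A W) f \<longleftrightarrow>
     (\<forall>u\<in>carrier U. \<forall>v\<in>carrier V. f u v \<in> carrier W) \<and>
     (\<forall>u\<in>carrier U. \<forall>v\<in>carrier V. \<forall>v'\<in>carrier V.
        f u (v \<oplus>\<^bsub>V\<^esub> v') = f u v \<oplus>\<^bsub>W\<^esub> f u v') \<and>
     (\<forall>u\<in>carrier U. \<forall>u'\<in>carrier U. \<forall>v\<in>carrier V.
        f (u \<oplus>\<^bsub>U\<^esub> u') v = f u v \<oplus>\<^bsub>W\<^esub> f u' v) \<and>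
     (\<forall>k\<in>carrier K. \<forall>u\<in>carrier U. \<forall>v\<in>carrier V.
        f u ((k \<odot>\<^bsub>A\<^esub> \<one>\<^bsub>A\<^esub>) \<odot>\<^bsub>V\<^esub> v) = (k \<odot>\<^bsub>A\<^esub> \<one>\<^bsub>A\<^esub>) \<odot>\<^bsub>W\<^esub> f u v) \<and>
     (\<forall>k\<in>carrier K. \<forall>u\<in>carrier U. \<forall>v\<in>carrier V.
        f ((k \<odot>\<^bsub>A\<^esub> \<one>\<^bsub>A\<^esub>) \<odot>\<^bsub>U\<^esub> u) v = (k \<odot>\<^bsub>A\<^esub> \<one>\<^bsub>A\<^esub>) \<odot>\<^bsub>W\<^esub> f u v)"
  unfolding bilinear_on_def module_hom_def restrict_scalars_def
  by (auto simp: Pi_iff)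

text \<open>Maps are total functions, so agreement on the carriers is weaker than equality. The
  module and algebra assumptions keep the sums and the multiples by \<open>k \<odot> \<one>\<close>
  in the carriers, where \<open>eq\<close> may be applied.\<close>

lemma bilinear_on_restrict_scalars_cong:
  assumes "module A U" "module A V" "algebra K A"
    and "bilinear_on K (restrict_scalars A U) (restrict_scalars A V) (restrict_scalars A W) f"
    and eq: "\<And>u v. \<lbrakk>u \<in> carrier U; v \<in> carrier V\<rbrakk> \<Longrightarrow> g u v = f u v"
  shows "bilinear_on K (restrict_scalars A U) (restrict_scalars A V) (restrict_scalars A W) g"
proof -
  interpret U: module A U by fact
  interpret V: module A V by fact
  interpret algebra K A by fact
  show ?thesis
    using assms(4) by (simp add: bilinear_on_restrict_scalars eq)
qed


text \<open>
  The ring normalisation rules do not cancel opposite terms that are far apart in a sum, hence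
  the following identities.
\<close>

context abelian_group
begin

lemma leibniz_cancel:
  assumes "a \<in> carrier G" "b \<in> carrier G" "c \<in> carrier G"
  shows "(a \<oplus> b) \<ominus> (c \<oplus> a) = b \<ominus> c"
proof -
  have "(a \<oplus> b) \<ominus> (c \<oplus> a) = (b \<ominus> c) \<oplus> (a \<oplus> \<ominus> a)"
    using assms by (simp only: a_minus_def minus_add a_ac a_closed a_inv_closed)
  with assms show ?thesis by (simp add: r_neg)
qed

text \<open>For the bracket of two dual operators, evaluated at m: \<open>p\<close> and
  \<open>q\<close> are the mixed terms ell(x)<\<xi>, \<theta>(y)m> and ell(y)<\<xi>, \<theta>(x)m>.
  Both occur in either order of composition.\<close>

lemma dual_bracket_cancel:
  assumes "a \<in> carrier G" "b \<in> carrier G" "c \<in> carrier G" "d \<in> carrier G"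
    and "p \<in> carrier G" "q \<in> carrier G"
  shows "((a \<ominus> p) \<ominus> (q \<ominus> d)) \<ominus> ((b \<ominus> q) \<ominus> (p \<ominus> c)) = (a \<ominus> b) \<ominus> (c \<ominus> d)"
proof -
  have "((a \<ominus> p) \<ominus> (q \<ominus> d)) \<ominus> ((b \<ominus> q) \<ominus> (p \<ominus> c)) =
      ((a \<ominus> b) \<ominus> (c \<ominus> d)) \<oplus> ((p \<oplus> \<ominus> p) \<oplus> (q \<oplus> \<ominus> q))"
    using assms by (simp only: a_minus_def minus_add minus_minus a_ac a_closed a_inv_closed)
  with assms show ?thesis by (simp add: r_neg)
qed

text \<open>For the bracket of \<rho>(x) - \<mu>(x) and \<rho>(y) - \<mu>(y), after each \<rho>\<mu>
  has been rewritten by the compatibility condition: \<open>p\<close>, \<open>q\<close> are the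
  terms \<mu>(x)\<rho>(y)m, \<mu>(y)\<rho>(x)m, and \<open>r\<close>, \<open>s\<close> are
  \<mu>(x)\<mu>(y)m, \<mu>(y)\<mu>(x)m. What survives is the commutator of \<rho> and the terms
  \<open>c\<close>, \<open>d\<close>, namely \<mu>(x.y)m and \<mu>(y.x)m.\<close>

lemma difference_bracket_cancel:
  assumes "a \<in> carrier G" "b \<in> carrier G" "c \<in> carrier G" "d \<in> carrier G"
    and "p \<in> carrier G" "q \<in> carrier G" "r \<in> carrier G" "s \<in> carrier G"
  shows "((a \<ominus> (q \<oplus> (c \<ominus> s))) \<ominus> (p \<ominus> r)) \<ominus> ((b \<ominus> (p \<oplus> (d \<ominus> r))) \<ominus> (q \<ominus> s)) =
    (a \<ominus> b) \<ominus> (c \<ominus> d)"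
proof -
  have "((a \<ominus> (q \<oplus> (c \<ominus> s))) \<ominus> (p \<ominus> r)) \<ominus> ((b \<ominus> (p \<oplus> (d \<ominus> r))) \<ominus> (q \<ominus> s)) =
      ((a \<ominus> b) \<ominus> (c \<ominus> d)) \<oplus>
      ((p \<oplus> \<ominus> p) \<oplus> ((q \<oplus> \<ominus> q) \<oplus> ((r \<oplus> \<ominus> r) \<oplus> (s \<oplus> \<ominus> s))))"
    using assms by (simp only: a_minus_def minus_add minus_minus a_ac a_closed a_inv_closed)
  with assms show ?thesis by (simp add: r_neg)
qed

text \<open>For the compatibility condition on the dual: \<open>a\<close> is ell(x)<\<xi>,
  \<mu>(y)m>, and \<open>b\<close>, \<open>c\<close>, \<open>d\<close>, \<open>p\<close> are the
  values of \<xi> at \<mu>(y)\<rho>(x)m, \<mu>(y)\<mu>(x)m, \<mu>(x)\<mu>(y)m and \<mu>(x.y)m. The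
  sum \<open>b \<oplus> (p \<ominus> c)\<close> stands for <\<xi>, \<rho>(x)\<mu>(y)m>.\<close>

lemma dual_compatibility_cancel:
  assumes "a \<in> carrier G" "b \<in> carrier G" "c \<in> carrier G" "d \<in> carrier G" "p \<in> carrier G"
  shows "((a \<ominus> b) \<ominus> \<ominus> c) \<ominus> ((a \<ominus> (b \<oplus> (p \<ominus> c))) \<ominus> \<ominus> d) = p \<ominus> d"
proof -
  have "((a \<ominus> b) \<ominus> \<ominus> c) \<ominus> ((a \<ominus> (b \<oplus> (p \<ominus> c))) \<ominus> \<ominus> d) =
      (p \<ominus> d) \<oplus> ((a \<oplus> \<ominus> a) \<oplus> ((b \<oplus> \<ominus> b) \<oplus> (c \<oplus> \<ominus> c)))"
    using assms by (simp only: a_minus_def minus_add minus_minus a_ac a_closed a_inv_closed)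
  with assms show ?thesis by (simp add: r_neg)
qed

end


section \<open>The dual module\<close>

text \<open>The dual is a construction over the ring \<open>A\<close> alone; the record type with
  scalars in \<open>'k\<close> is kept so that \<open>dual_module\<close> applies.\<close>

locale module_over_algebra = A?: cring A + M?: module A M
  for A :: "('k, 'a) module" and M :: "('a, 'm) module"
begin

lemmas ring_normalize = A.cring_simprules

lemmas leibniz_cancel = A.leibniz_cancel
  and dual_bracket_cancel = A.dual_bracket_cancel
  and dual_compatibility_cancel = A.dual_compatibility_cancel

abbreviation D :: "('a, 'm \<Rightarrow> 'a) module" where "D \<equiv> dual_module A M"

lemma dual_carrierI:
  assumes "\<xi> \<in> extensional (carrier M)"
    and "\<And>m. m \<in> carrier M \<Longrightarrow> \<xi> m \<in> carrier A"
    and "\<And>m n. \<lbrakk>m \<in> carrier M; n \<in> carrier M\<rbrakk> \<Longrightarrow> \<xi> (m \<oplus>\<^bsub>M\<^esub> n) = \<xi> m \<oplus>\<^bsub>A\<^esub> \<xi> n"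
    and "\<And>a m. \<lbrakk>a \<in> carrier A; m \<in> carrier M\<rbrakk> \<Longrightarrow> \<xi> (a \<odot>\<^bsub>M\<^esub> m) = a \<otimes>\<^bsub>A\<^esub> \<xi> m"
  shows "\<xi> \<in> carrier D"
  using assms by (auto simp: dual_module_def module_hom_def regular_module_def)

lemma
  assumes "\<xi> \<in> carrier D"
  shows dual_extensional: "\<xi> \<in> extensional (carrier M)"
    and dual_closed [simp]: "m \<in> carrier M \<Longrightarrow> \<xi> m \<in> carrier A"
    and dual_add: "\<lbrakk>m \<in> carrier M; n \<in> carrier M\<rbrakk> \<Longrightarrow> \<xi> (m \<oplus>\<^bsub>M\<^esub> n) = \<xi> m \<oplus>\<^bsub>A\<^esub> \<xi> n"
    and dual_smult: "\<lbrakk>a \<in> carrier A; m \<in> carrier M\<rbrakk> \<Longrightarrow> \<xi> (a \<odot>\<^bsub>M\<^esub> m) = a \<otimes>\<^bsub>A\<^esub> \<xi> m"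
  using assms by (auto simp: dual_module_def module_hom_def regular_module_def)

lemma dual_eqI:
  assumes "\<xi> \<in> carrier D" "\<eta> \<in> carrier D" "\<And>m. m \<in> carrier M \<Longrightarrow> \<xi> m = \<eta> m"
  shows "\<xi> = \<eta>"
  using assms by (intro extensionalityI[OF dual_extensional dual_extensional])

text \<open>Negation is multiplication by -1 in \<open>A\<close>, so \<open>A\<close>-homogeneity
  suffices. The same device handles negatives in both arguments of \<mu>.\<close>

lemma dual_minus:
  assumes "\<xi> \<in> carrier D" "m \<in> carrier M"
  shows "\<xi> (\<ominus>\<^bsub>M\<^esub> m) = \<ominus>\<^bsub>A\<^esub> \<xi> m"
proof -
  have "\<ominus>\<^bsub>M\<^esub> m = (\<ominus>\<^bsub>A\<^esub> \<one>\<^bsub>A\<^esub>) \<odot>\<^bsub>M\<^esub> m"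
    using assms by (simp add: M.smult_l_minus)
  with assms show ?thesis
    by (simp add: dual_smult A.l_minus)
qed

lemma dual_diff:
  assumes "\<xi> \<in> carrier D" "m \<in> carrier M" "n \<in> carrier M"
  shows "\<xi> (m \<ominus>\<^bsub>M\<^esub> n) = \<xi> m \<ominus>\<^bsub>A\<^esub> \<xi> n"
  using assms by (simp add: a_minus_def dual_add dual_minus)

lemma add_dual_apply [simp]: "m \<in> carrier M \<Longrightarrow> (\<xi> \<oplus>\<^bsub>D\<^esub> \<eta>) m = \<xi> m \<oplus>\<^bsub>A\<^esub> \<eta> m"
  and smult_dual_apply [simp]: "m \<in> carrier M \<Longrightarrow> (a \<odot>\<^bsub>D\<^esub> \<xi>) m = a \<otimes>\<^bsub>A\<^esub> \<xi> m"
  and zero_dual_apply [simp]: "m \<in> carrier M \<Longrightarrow> \<zero>\<^bsub>D\<^esub> m = \<zero>\<^bsub>A\<^esub>"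
  by (simp_all add: dual_module_def)

lemma dual_ops_extensional:
  "\<xi> \<oplus>\<^bsub>D\<^esub> \<eta> \<in> extensional (carrier M)" "a \<odot>\<^bsub>D\<^esub> \<xi> \<in> extensional (carrier M)"
  "\<zero>\<^bsub>D\<^esub> \<in> extensional (carrier M)"
  by (simp_all add: dual_module_def)

lemma add_dual_closed: "\<lbrakk>\<xi> \<in> carrier D; \<eta> \<in> carrier D\<rbrakk> \<Longrightarrow> \<xi> \<oplus>\<^bsub>D\<^esub> \<eta> \<in> carrier D"
  by (intro dual_carrierI)
    (simp_all add: dual_ops_extensional dual_add dual_smult A.r_distr A.a_ac)

lemma smult_dual_closed: "\<lbrakk>a \<in> carrier A; \<xi> \<in> carrier D\<rbrakk> \<Longrightarrow> a \<odot>\<^bsub>D\<^esub> \<xi> \<in> carrier D"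
  by (intro dual_carrierI)
    (simp_all add: dual_ops_extensional dual_add dual_smult A.r_distr A.m_ac)

lemma zero_dual_closed: "\<zero>\<^bsub>D\<^esub> \<in> carrier D"
  by (intro dual_carrierI) (simp_all add: dual_ops_extensional)

lemmas dual_ops_closed = add_dual_closed smult_dual_closed zero_dual_closed

lemma module_dual: "module A D"
proof (rule moduleI)
  show "abelian_group D"
  proof (rule abelian_groupI)
    fix \<xi> assume \<xi>: "\<xi> \<in> carrier D"
    \<comment> \<open>The inverse is taken to be (-1)\<xi>, which is in the carrier by closure under
      scalars; the laws for \<open>\<ominus>\<close> in \<open>D\<close> presuppose the group
      structure being proved.\<close>
    have "(\<ominus>\<^bsub>A\<^esub> \<one>\<^bsub>A\<^esub>) \<odot>\<^bsub>D\<^esub> \<xi> \<oplus>\<^bsub>D\<^esub> \<xi> = \<zero>\<^bsub>D\<^esub>"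
      using \<xi> by (intro dual_eqI) (simp_all add: dual_ops_closed A.l_minus A.l_neg)
    then show "\<exists>\<eta>\<in>carrier D. \<eta> \<oplus>\<^bsub>D\<^esub> \<xi> = \<zero>\<^bsub>D\<^esub>"
      using \<xi> by (meson smult_dual_closed A.a_inv_closed A.one_closed)
  qed (auto intro!: dual_eqI simp: dual_ops_closed A.a_ac)
qed (auto intro!: dual_eqI A.is_cring simp: dual_ops_closed A.l_distr A.r_distr A.m_assoc)

sublocale dual: module A D
  by (rule module_dual)

text \<open>The negative in a record is a definite description and cannot be evaluated by unfolding
  \<open>dual_module\<close>. Multiplication by -1 is pointwise by definition.\<close>

lemma minus_dual_apply [simp]:
  assumes "\<xi> \<in> carrier D" "m \<in> carrier M"
  shows "(\<ominus>\<^bsub>D\<^esub> \<xi>) m = \<ominus>\<^bsub>A\<^esub> \<xi> m"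
proof -
  have "\<ominus>\<^bsub>D\<^esub> \<xi> = (\<ominus>\<^bsub>A\<^esub> \<one>\<^bsub>A\<^esub>) \<odot>\<^bsub>D\<^esub> \<xi>"
    using assms by (simp add: dual.smult_l_minus)
  with assms show ?thesis
    by (simp add: A.l_minus)
qed

lemma diff_dual_apply [simp]:
  "\<lbrakk>\<xi> \<in> carrier D; \<eta> \<in> carrier D; m \<in> carrier M\<rbrakk> \<Longrightarrow> (\<xi> \<ominus>\<^bsub>D\<^esub> \<eta>) m = \<xi> m \<ominus>\<^bsub>A\<^esub> \<eta> m"
  by (simp add: a_minus_def)

end


section \<open>Representations of Lie--Rinehart algebras\<close>

context lie_rinehart_algebra
begin

lemma
  assumes "x \<in> carrier L" "a \<in> carrier A"
  shows ell_closed [simp]: "ell x a \<in> carrier A"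
    and ell_add: "b \<in> carrier A \<Longrightarrow> ell x (a \<oplus>\<^bsub>A\<^esub> b) = ell x a \<oplus>\<^bsub>A\<^esub> ell x b"
    and ell_mult:
      "b \<in> carrier A \<Longrightarrow> ell x (a \<otimes>\<^bsub>A\<^esub> b) = ell x a \<otimes>\<^bsub>A\<^esub> b \<oplus>\<^bsub>A\<^esub> a \<otimes>\<^bsub>A\<^esub> ell x b"
    and ell_add_left:
      "y \<in> carrier L \<Longrightarrow> ell (x \<oplus>\<^bsub>L\<^esub> y) a = ell x a \<oplus>\<^bsub>A\<^esub> ell y a"
  using assms anchor_derivation[of x] anchor_linear
  by (auto simp: derivations_def module_hom_def bilinear_on_def restrict_scalars_def)

text \<open>In the algebra (k1)a = ka, so this is \<open>K\<close>-linearity of a derivation in the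
  form that restriction of scalars produces.\<close>

lemma ell_scalar:
  assumes "x \<in> carrier L" "a \<in> carrier A" "k \<in> carrier K"
  shows "ell x ((k \<odot>\<^bsub>A\<^esub> \<one>\<^bsub>A\<^esub>) \<otimes>\<^bsub>A\<^esub> a) = (k \<odot>\<^bsub>A\<^esub> \<one>\<^bsub>A\<^esub>) \<otimes>\<^bsub>A\<^esub> ell x a"
  using assms anchor_derivation[of x] by (simp add: A.smult_assoc2 derivations_def module_hom_def)

lemma ell_minus:
  assumes "x \<in> carrier L" "a \<in> carrier A"
  shows "ell x (\<ominus>\<^bsub>A\<^esub> a) = \<ominus>\<^bsub>A\<^esub> ell x a"
proof -
  have "ell x \<zero>\<^bsub>A\<^esub> = \<zero>\<^bsub>A\<^esub>"
    using ell_add[of x "\<zero>\<^bsub>A\<^esub>" "\<zero>\<^bsub>A\<^esub>"] assms by simp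
  then have "ell x (\<ominus>\<^bsub>A\<^esub> a) \<oplus>\<^bsub>A\<^esub> ell x a = \<zero>\<^bsub>A\<^esub>"
    using assms by (simp flip: ell_add add: A.M.l_neg)
  then show ?thesis
    using assms by (simp add: A.M.minus_equality)
qed

lemma ell_diff:
  "\<lbrakk>x \<in> carrier L; a \<in> carrier A; b \<in> carrier A\<rbrakk> \<Longrightarrow> ell x (a \<ominus>\<^bsub>A\<^esub> b) = ell x a \<ominus>\<^bsub>A\<^esub> ell x b"
  by (simp add: a_minus_def ell_add ell_minus)

lemma bracket_closed [simp]: "\<lbrakk>x \<in> carrier L; y \<in> carrier L\<rbrakk> \<Longrightarrow> br x y \<in> carrier L"
  using br_bilinear by (simp add: bilinear_on_restrict_scalars)

end

context lie_rinehart_representation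
begin

sublocale module_over_algebra A M
  by unfold_locales

lemma
  assumes "x \<in> carrier L" "m \<in> carrier M"
  shows rep_closed [simp]: "\<theta> x m \<in> carrier M"
    and rep_add: "n \<in> carrier M \<Longrightarrow> \<theta> x (m \<oplus>\<^bsub>M\<^esub> n) = \<theta> x m \<oplus>\<^bsub>M\<^esub> \<theta> x n"
    and rep_add_left: "y \<in> carrier L \<Longrightarrow> \<theta> (x \<oplus>\<^bsub>L\<^esub> y) m = \<theta> x m \<oplus>\<^bsub>M\<^esub> \<theta> y m"
  using assms rep_linear by (simp_all add: bilinear_on_restrict_scalars)

text \<open>\<theta>(x) need not be \<open>A\<close>-linear: multiplication by -1 would bring in
  ell(x)(-1). Additivity alone is used instead.\<close>

lemma rep_minus: "\<lbrakk>x \<in> carrier L; m \<in> carrier M\<rbrakk> \<Longrightarrow> \<theta> x (\<ominus>\<^bsub>M\<^esub> m) = \<ominus>\<^bsub>M\<^esub> \<theta> x m"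
proof -
  assume *: "x \<in> carrier L" "m \<in> carrier M"
  have "\<theta> x \<zero>\<^bsub>M\<^esub> = \<zero>\<^bsub>M\<^esub>"
    using rep_add[of x "\<zero>\<^bsub>M\<^esub>" "\<zero>\<^bsub>M\<^esub>"] * by simp
  then have "\<theta> x (\<ominus>\<^bsub>M\<^esub> m) \<oplus>\<^bsub>M\<^esub> \<theta> x m = \<zero>\<^bsub>M\<^esub>"
    using * by (simp flip: rep_add add: M.M.l_neg)
  then show "\<theta> x (\<ominus>\<^bsub>M\<^esub> m) = \<ominus>\<^bsub>M\<^esub> \<theta> x m"
    using * by (simp add: M.M.minus_equality)
qed

text \<open>Serves to transport the structure from the dual of \<rho> - \<mu> to the difference of
  the duals, which is only known to agree with it on the carriers.\<close>

lemma representation_cong: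
  assumes eq: "\<And>x m. \<lbrakk>x \<in> carrier L; m \<in> carrier M\<rbrakk> \<Longrightarrow> \<theta>' x m = \<theta> x m"
  shows "lie_rinehart_representation K A L br ell M \<theta>'"
proof unfold_locales
  show "bilinear_on K (restrict_scalars A L) (restrict_scalars A M) (restrict_scalars A M) \<theta>'"
    using rep_linear eq
    by (rule bilinear_on_restrict_scalars_cong[rotated 3]) unfold_locales
qed (simp_all add: eq rep_bracket rep_smult rep_leibniz)

lemma rho_star_apply:
  "m \<in> carrier M \<Longrightarrow> rho_star A ell M \<theta> x \<xi> m = ell x (\<xi> m) \<ominus>\<^bsub>A\<^esub> \<xi> (\<theta> x m)"
  by (simp add: rho_star_def)

text \<open>Neither ell(x) after \<xi> nor \<xi> after \<theta>(x) is \<open>A\<close>-linear in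
  general, but both deviate by the same term ell(x)(a)<\<xi>, m>, which
  \<open>leibniz_cancel\<close> removes from the difference.\<close>

lemma rho_star_closed [simp]:
  assumes "x \<in> carrier L" "\<xi> \<in> carrier D"
  shows "rho_star A ell M \<theta> x \<xi> \<in> carrier D"
proof (rule dual_carrierI)
  fix a m assume "a \<in> carrier A" "m \<in> carrier M"
  then show "rho_star A ell M \<theta> x \<xi> (a \<odot>\<^bsub>M\<^esub> m) = a \<otimes>\<^bsub>A\<^esub> rho_star A ell M \<theta> x \<xi> m"
    using assms
    by (simp add: rho_star_apply dual_smult dual_add rep_leibniz ell_mult leibniz_cancel)
      (simp add: ring_normalize)
next
  fix m n assume "m \<in> carrier M" "n \<in> carrier M"
  then show "rho_star A ell M \<theta> x \<xi> (m \<oplus>\<^bsub>M\<^esub> n) =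
      rho_star A ell M \<theta> x \<xi> m \<oplus>\<^bsub>A\<^esub> rho_star A ell M \<theta> x \<xi> n"
    using assms
    by (simp add: rho_star_apply dual_add rep_add ell_add ring_normalize)
qed (use assms in \<open>simp_all add: rho_star_apply, simp add: rho_star_def\<close>)

text \<open>Composing dual operators reverses the order of the factors \<theta>, so their commutator
  contributes -<\<xi>, \<theta>([x,y])m>, with the very sign that \<theta> has in
  \<open>rho_star\<close>. The anchor terms give ell([x,y])<\<xi>, m>.\<close>

theorem dual_representation:
  "lie_rinehart_representation K A L br ell D (rho_star A ell M \<theta>)"
proof (intro lie_rinehart_representation.intro lie_rinehart_representation_axioms.intro)
  show "lie_rinehart_algebra K A L br ell" "module A D" by unfold_locales
  let ?\<sigma> = "rho_star A ell M \<theta>"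
  show "bilinear_on K (restrict_scalars A L) (restrict_scalars A D) (restrict_scalars A D) ?\<sigma>"
    unfolding bilinear_on_restrict_scalars
  proof (intro conjI ballI)
    fix k x \<xi> assume c: "k \<in> carrier K" "x \<in> carrier L" "\<xi> \<in> carrier D"
    then have k: "k \<odot>\<^bsub>A\<^esub> \<one>\<^bsub>A\<^esub> \<in> carrier A" by simp
    show "?\<sigma> x ((k \<odot>\<^bsub>A\<^esub> \<one>\<^bsub>A\<^esub>) \<odot>\<^bsub>D\<^esub> \<xi>) = (k \<odot>\<^bsub>A\<^esub> \<one>\<^bsub>A\<^esub>) \<odot>\<^bsub>D\<^esub> ?\<sigma> x \<xi>"
      using c k by (intro dual_eqI) (simp_all add: rho_star_apply ell_scalar, simp_all add: ring_normalize)
    show "?\<sigma> ((k \<odot>\<^bsub>A\<^esub> \<one>\<^bsub>A\<^esub>) \<odot>\<^bsub>L\<^esub> x) \<xi> = (k \<odot>\<^bsub>A\<^esub> \<one>\<^bsub>A\<^esub>) \<odot>\<^bsub>D\<^esub> ?\<sigma> x \<xi>"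
      using c k
      by (intro dual_eqI) (simp_all add: rho_star_apply anchor_smult rep_smult dual_smult, simp_all add: ring_normalize)
  next
    fix x \<xi> \<eta> assume "x \<in> carrier L" "\<xi> \<in> carrier D" "\<eta> \<in> carrier D"
    then show "?\<sigma> x (\<xi> \<oplus>\<^bsub>D\<^esub> \<eta>) = ?\<sigma> x \<xi> \<oplus>\<^bsub>D\<^esub> ?\<sigma> x \<eta>"
      by (intro dual_eqI) (simp_all add: rho_star_apply ell_add, simp_all add: ring_normalize)
  next
    fix x y \<xi> assume "x \<in> carrier L" "y \<in> carrier L" "\<xi> \<in> carrier D"
    then show "?\<sigma> (x \<oplus>\<^bsub>L\<^esub> y) \<xi> = ?\<sigma> x \<xi> \<oplus>\<^bsub>D\<^esub> ?\<sigma> y \<xi>"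
      by (intro dual_eqI)
        (simp_all add: rho_star_apply ell_add_left rep_add_left dual_add, simp_all add: ring_normalize)
  qed simp
  show "?\<sigma> (br x y) \<xi> = ?\<sigma> x (?\<sigma> y \<xi>) \<ominus>\<^bsub>D\<^esub> ?\<sigma> y (?\<sigma> x \<xi>)"
    if "x \<in> carrier L" "y \<in> carrier L" "\<xi> \<in> carrier D" for x y \<xi>
    using that
    by (intro dual_eqI)
      (simp_all add: rho_star_apply anchor_bracket rep_bracket dual_diff ell_diff dual_bracket_cancel)
  show "?\<sigma> (a \<odot>\<^bsub>L\<^esub> x) \<xi> = a \<odot>\<^bsub>D\<^esub> ?\<sigma> x \<xi>"
    if "a \<in> carrier A" "x \<in> carrier L" "\<xi> \<in> carrier D" for a x \<xi>
    using that
    by (intro dual_eqI) (simp_all add: rho_star_apply anchor_smult rep_smult dual_smult, simp_all add: ring_normalize)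
  show "?\<sigma> x (a \<odot>\<^bsub>D\<^esub> \<xi>) = a \<odot>\<^bsub>D\<^esub> ?\<sigma> x \<xi> \<oplus>\<^bsub>D\<^esub> ell x a \<odot>\<^bsub>D\<^esub> \<xi>"
    if "a \<in> carrier A" "x \<in> carrier L" "\<xi> \<in> carrier D" for a x \<xi>
    using that
    by (intro dual_eqI) (simp_all add: rho_star_apply ell_mult, simp_all add: ring_normalize)
qed

end


section \<open>Representations of left-symmetric Rinehart algebras\<close>

context left_symmetric_rinehart_representation
begin

lemma
  assumes "x \<in> carrier L" "m \<in> carrier M"
  shows mu_closed [simp]: "\<mu> x m \<in> carrier M"
    and mu_add: "n \<in> carrier M \<Longrightarrow> \<mu> x (m \<oplus>\<^bsub>M\<^esub> n) = \<mu> x m \<oplus>\<^bsub>M\<^esub> \<mu> x n"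
    and mu_add_left: "y \<in> carrier L \<Longrightarrow> \<mu> (x \<oplus>\<^bsub>L\<^esub> y) m = \<mu> x m \<oplus>\<^bsub>M\<^esub> \<mu> y m"
  using assms mu_linear by (simp_all add: bilinear_on_restrict_scalars)

lemma mu_minus: "\<lbrakk>x \<in> carrier L; m \<in> carrier M\<rbrakk> \<Longrightarrow> \<mu> x (\<ominus>\<^bsub>M\<^esub> m) = \<ominus>\<^bsub>M\<^esub> \<mu> x m"
  using mu_smult_right[of "\<ominus>\<^bsub>A\<^esub> \<one>\<^bsub>A\<^esub>" x m] by (simp add: M.smult_l_minus)

lemma mu_minus_left:
  assumes "x \<in> carrier L" "m \<in> carrier M"
  shows "\<mu> (\<ominus>\<^bsub>L\<^esub> x) m = \<ominus>\<^bsub>M\<^esub> \<mu> x m"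
  using mu_smult_left[of "\<ominus>\<^bsub>A\<^esub> \<one>\<^bsub>A\<^esub>" x m] assms
  by (simp add: M.smult_l_minus L.smult_l_minus)

lemma product_closed [simp]: "\<lbrakk>x \<in> carrier L; y \<in> carrier L\<rbrakk> \<Longrightarrow> pr x y \<in> carrier L"
  using pr_bilinear by (simp add: bilinear_on_restrict_scalars)

text \<open>The compatibility condition solved for \<rho>(x)\<mu>(y): as a rewrite rule it moves
  \<rho> to the inside of \<mu>, so that like terms become syntactically equal.\<close>

lemma rho_mu_swap:
  assumes "x \<in> carrier L" "y \<in> carrier L" "m \<in> carrier M"
  shows "\<rho> x (\<mu> y m) = \<mu> y (\<rho> x m) \<oplus>\<^bsub>M\<^esub> (\<mu> (pr x y) m \<ominus>\<^bsub>M\<^esub> \<mu> y (\<mu> x m))"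
proof -
  have "\<mu> y (\<rho> x m) \<oplus>\<^bsub>M\<^esub> (\<rho> x (\<mu> y m) \<ominus>\<^bsub>M\<^esub> \<mu> y (\<rho> x m)) =
      \<rho> x (\<mu> y m) \<oplus>\<^bsub>M\<^esub> (\<mu> y (\<rho> x m) \<oplus>\<^bsub>M\<^esub> \<ominus>\<^bsub>M\<^esub> \<mu> y (\<rho> x m))"
    using assms by (simp only: a_minus_def M.M.a_ac M.M.a_closed M.M.a_inv_closed rep_closed
        mu_closed)
  with assms show ?thesis
    by (simp add: rho_mu M.M.r_neg)
qed

lemma rho_diff:
    "\<lbrakk>x \<in> carrier L; m \<in> carrier M; n \<in> carrier M\<rbrakk> \<Longrightarrow>
      \<rho> x (m \<ominus>\<^bsub>M\<^esub> n) = \<rho> x m \<ominus>\<^bsub>M\<^esub> \<rho> x n"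
  and mu_diff:
    "\<lbrakk>x \<in> carrier L; m \<in> carrier M; n \<in> carrier M\<rbrakk> \<Longrightarrow>
      \<mu> x (m \<ominus>\<^bsub>M\<^esub> n) = \<mu> x m \<ominus>\<^bsub>M\<^esub> \<mu> x n"
  by (simp_all add: a_minus_def rep_add rep_minus mu_add mu_minus)

theorem rho_minus_mu_representation:
  "lie_rinehart_representation K A L (commutator L pr) ell M (\<lambda>x m. \<rho> x m \<ominus>\<^bsub>M\<^esub> \<mu> x m)"
proof unfold_locales
  have k: "k \<odot>\<^bsub>A\<^esub> \<one>\<^bsub>A\<^esub> \<in> carrier A" if "k \<in> carrier K" for k
    using that by simp
  \<comment> \<open>This comes from \<open>K\<close>-linearity of \<rho>(x); the Leibniz rule for
    the scalar k1 would leave a term ell(x)(k1)m.\<close>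
  have \<rho>k: "\<rho> x ((k \<odot>\<^bsub>A\<^esub> \<one>\<^bsub>A\<^esub>) \<odot>\<^bsub>M\<^esub> m) = (k \<odot>\<^bsub>A\<^esub> \<one>\<^bsub>A\<^esub>) \<odot>\<^bsub>M\<^esub> \<rho> x m"
    if "k \<in> carrier K" "x \<in> carrier L" "m \<in> carrier M" for k x m
    using that rep_linear by (simp add: bilinear_on_restrict_scalars)
  show "bilinear_on K (restrict_scalars A L) (restrict_scalars A M) (restrict_scalars A M)
     (\<lambda>x m. \<rho> x m \<ominus>\<^bsub>M\<^esub> \<mu> x m)"
    unfolding bilinear_on_restrict_scalars
    by (auto simp: k \<rho>k a_minus_def rep_add rep_add_left mu_add mu_add_left rep_smult
        mu_smult_left M.smult_r_distr M.smult_r_minus M.M.minus_add M.M.a_ac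
        simp flip: mu_smult_right)
  show "\<rho> (commutator L pr x y) m \<ominus>\<^bsub>M\<^esub> \<mu> (commutator L pr x y) m =
      \<rho> x (\<rho> y m \<ominus>\<^bsub>M\<^esub> \<mu> y m) \<ominus>\<^bsub>M\<^esub> \<mu> x (\<rho> y m \<ominus>\<^bsub>M\<^esub> \<mu> y m) \<ominus>\<^bsub>M\<^esub>
      (\<rho> y (\<rho> x m \<ominus>\<^bsub>M\<^esub> \<mu> x m) \<ominus>\<^bsub>M\<^esub> \<mu> y (\<rho> x m \<ominus>\<^bsub>M\<^esub> \<mu> x m))"
    if "x \<in> carrier L" "y \<in> carrier L" "m \<in> carrier M" for x y m
  proof -
    \<comment> \<open>\<mu> is not assumed to respect the bracket, so only its linearity in the
      algebra variable is used here.\<close>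
    have "\<mu> (commutator L pr x y) m = \<mu> (pr x y) m \<ominus>\<^bsub>M\<^esub> \<mu> (pr y x) m"
      using that by (simp add: commutator_def a_minus_def mu_add_left mu_minus_left)
    with that show ?thesis
      by (simp add: rep_bracket rho_diff mu_diff rho_mu_swap M.M.difference_bracket_cancel)
  qed
  show "\<rho> (a \<odot>\<^bsub>L\<^esub> x) m \<ominus>\<^bsub>M\<^esub> \<mu> (a \<odot>\<^bsub>L\<^esub> x) m = a \<odot>\<^bsub>M\<^esub> (\<rho> x m \<ominus>\<^bsub>M\<^esub> \<mu> x m)"
    if "a \<in> carrier A" "x \<in> carrier L" "m \<in> carrier M" for a x m
    using that
    by (simp add: a_minus_def rep_smult mu_smult_left M.smult_r_distr M.smult_r_minus)
  \<comment> \<open>The anchor term comes from \<rho> alone, because \<mu>(x) is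
    \<open>A\<close>-linear.\<close>
  show "\<rho> x (a \<odot>\<^bsub>M\<^esub> m) \<ominus>\<^bsub>M\<^esub> \<mu> x (a \<odot>\<^bsub>M\<^esub> m) =
      a \<odot>\<^bsub>M\<^esub> (\<rho> x m \<ominus>\<^bsub>M\<^esub> \<mu> x m) \<oplus>\<^bsub>M\<^esub> ell x a \<odot>\<^bsub>M\<^esub> m"
    if "a \<in> carrier A" "x \<in> carrier L" "m \<in> carrier M" for a x m
    using that
    by (simp add: a_minus_def rep_leibniz M.smult_r_distr M.smult_r_minus M.M.a_ac
        flip: mu_smult_right)
qed

lemma mu_star_apply: "m \<in> carrier M \<Longrightarrow> mu_star A M \<mu> x \<xi> m = \<ominus>\<^bsub>A\<^esub> \<xi> (\<mu> x m)"
  by (simp add: mu_star_def)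

text \<open>Up to sign this is a composite of the \<open>A\<close>-linear maps \<mu>(x) and \<xi>,
  so no correction by the anchor is needed.\<close>

lemma mu_star_closed [simp]:
  assumes "x \<in> carrier L" "\<xi> \<in> carrier D"
  shows "mu_star A M \<mu> x \<xi> \<in> carrier D"
proof (rule dual_carrierI)
  show "mu_star A M \<mu> x \<xi> (a \<odot>\<^bsub>M\<^esub> m) = a \<otimes>\<^bsub>A\<^esub> mu_star A M \<mu> x \<xi> m"
    if "a \<in> carrier A" "m \<in> carrier M" for a m
    using assms that by (simp add: mu_star_apply dual_smult A.r_minus flip: mu_smult_right)
qed (use assms in \<open>simp_all add: mu_star_apply mu_add dual_add ring_normalize,
    simp add: mu_star_def\<close>)

theorem dual_representation_left_symmetric:
  "left_symmetric_rinehart_representation K A L pr ell D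
     (\<lambda>x \<xi>. rho_star A ell M \<rho> x \<xi> \<ominus>\<^bsub>D\<^esub> mu_star A M \<mu> x \<xi>)
     (\<lambda>x \<xi>. \<ominus>\<^bsub>D\<^esub> mu_star A M \<mu> x \<xi>)"
proof (intro left_symmetric_rinehart_representation.intro
    left_symmetric_rinehart_representation_axioms.intro)
  let ?\<sigma> = "\<lambda>x \<xi>. rho_star A ell M \<rho> x \<xi> \<ominus>\<^bsub>D\<^esub> mu_star A M \<mu> x \<xi>"
  \<comment> \<open>The two signs cancel: \<open>?\<nu> x \<xi>\<close> sends m to <\<xi>,
    \<mu>(x)m>, so \<open>?\<nu>\<close> is the plain transpose of \<mu>.\<close>
  let ?\<nu> = "\<lambda>x \<xi>. \<ominus>\<^bsub>D\<^esub> mu_star A M \<mu> x \<xi>"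
  show "left_symmetric_rinehart_algebra K A L pr ell" by unfold_locales
  interpret diff: lie_rinehart_representation K A L "commutator L pr" ell M
    "\<lambda>x m. \<rho> x m \<ominus>\<^bsub>M\<^esub> \<mu> x m"
    by (rule rho_minus_mu_representation)
  interpret diff_dual: lie_rinehart_representation K A L "commutator L pr" ell D
    "rho_star A ell M (\<lambda>x m. \<rho> x m \<ominus>\<^bsub>M\<^esub> \<mu> x m)"
    by (rule diff.dual_representation)
  \<comment> \<open>At m both sides equal ell(x)<\<xi>, m> - <\<xi>, \<rho>(x)m> + <\<xi>,
    \<mu>(x)m>.\<close>
  have \<sigma>_eq: "?\<sigma> x \<xi> = rho_star A ell M (\<lambda>x m. \<rho> x m \<ominus>\<^bsub>M\<^esub> \<mu> x m) x \<xi>"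
    if "x \<in> carrier L" "\<xi> \<in> carrier D" for x \<xi>
    using that
    by (intro dual_eqI)
      (simp_all add: rho_star_apply diff.rho_star_apply mu_star_apply dual_diff, simp_all add: ring_normalize)
  then show "lie_rinehart_representation K A L (commutator L pr) ell D ?\<sigma>"
    by (rule diff_dual.representation_cong)
  \<comment> \<open>The \<open>A\<close>-linearity in both arguments is proved first, since the case
    a = k1 gives the homogeneity over \<open>K\<close> in the bilinearity that follows.\<close>
  show \<nu>_smult_left: "?\<nu> (a \<odot>\<^bsub>L\<^esub> x) \<xi> = a \<odot>\<^bsub>D\<^esub> ?\<nu> x \<xi>"
    and \<nu>_smult_right: "a \<odot>\<^bsub>D\<^esub> ?\<nu> x \<xi> = ?\<nu> x (a \<odot>\<^bsub>D\<^esub> \<xi>)"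
    if "a \<in> carrier A" "x \<in> carrier L" "\<xi> \<in> carrier D" for a x \<xi>
    using that
    by (auto intro!: dual_eqI simp: mu_star_apply mu_smult_left dual_smult simp flip: mu_smult_right)
  show "bilinear_on K (restrict_scalars A L) (restrict_scalars A D) (restrict_scalars A D) ?\<nu>"
    unfolding bilinear_on_restrict_scalars
    by (auto intro!: dual_eqI simp: \<nu>_smult_left mu_star_apply mu_add_left dual_add
        simp flip: \<nu>_smult_right)
  show "?\<sigma> x (?\<nu> y \<xi>) \<ominus>\<^bsub>D\<^esub> ?\<nu> y (?\<sigma> x \<xi>) = ?\<nu> (pr x y) \<xi> \<ominus>\<^bsub>D\<^esub> ?\<nu> y (?\<nu> x \<xi>)"
    if c: "x \<in> carrier L" "y \<in> carrier L" "\<xi> \<in> carrier D" for x y \<xi>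
  proof (rule dual_eqI)
    fix m assume m: "m \<in> carrier M"
    \<comment> \<open>The left side is the only term of the goal at m in which \<rho> is applied
      after \<mu>; it comes from \<open>?\<nu> y (?\<sigma> x \<xi>)\<close>, as transposing
      reverses the order.\<close>
    have "\<xi> (\<rho> x (\<mu> y m)) = \<xi> (\<mu> y (\<rho> x m)) \<oplus>\<^bsub>A\<^esub>
        (\<xi> (\<mu> (pr x y) m) \<ominus>\<^bsub>A\<^esub> \<xi> (\<mu> y (\<mu> x m)))"
      using c m by (simp add: rho_mu_swap dual_add dual_diff)
    with c m show "(?\<sigma> x (?\<nu> y \<xi>) \<ominus>\<^bsub>D\<^esub> ?\<nu> y (?\<sigma> x \<xi>)) m =
        (?\<nu> (pr x y) \<xi> \<ominus>\<^bsub>D\<^esub> ?\<nu> y (?\<nu> x \<xi>)) m"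
      by (simp add: rho_star_apply mu_star_apply dual_compatibility_cancel)
  qed (use c in simp_all)
qed unfold_locales

end

theorem proposition4p3:
  fixes K :: "'k ring" and A :: "('k, 'a) module" and L :: "('a, 'l) module"
    and pr :: "'l \<Rightarrow> 'l \<Rightarrow> 'l" and ell :: "'l \<Rightarrow> 'a \<Rightarrow> 'a"
    and M :: "('a, 'm) module" and \<rho> \<mu> :: "'l \<Rightarrow> 'm \<Rightarrow> 'm"
  assumes "char_zero_field K"
    and "left_symmetric_rinehart_algebra K A L pr ell"
    and "left_symmetric_rinehart_representation K A L pr ell M \<rho> \<mu>"
  shows "lie_rinehart_representation K A L (commutator L pr) ell M
           (\<lambda>x m. \<rho> x m \<ominus>\<^bsub>M\<^esub> \<mu> x m)
    \<and> left_symmetric_rinehart_representation K A L pr ell (dual_module A M)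
           (\<lambda>x \<xi>. rho_star A ell M \<rho> x \<xi> \<ominus>\<^bsub>dual_module A M\<^esub> mu_star A M \<mu> x \<xi>)
           (\<lambda>x \<xi>. \<ominus>\<^bsub>dual_module A M\<^esub> mu_star A M \<mu> x \<xi>)"
  using left_symmetric_rinehart_representation.rho_minus_mu_representation[OF assms(3)]
    left_symmetric_rinehart_representation.dual_representation_left_symmetric[OF assms(3)]
  by blast

end
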